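(* Let $f\colon \mathbb{N} \to \mathbb{N}$ be a non-decreasing function that majorizes the identity function (that is, $f(n) \geq n$ for all $n$). The graph class $\mathcal{P}$ is $\chi$-bounded with $\chi$-binding function $f$ if and only if $$c_{\mathcal{P}}(G) \geq \left\lceil \frac{\log \chi(G)}{\log f(\omega(G))} \right\rceil$$ for all graphs $G$.
   Context: $\chi$ denotes the chromatic number and $\omega$ the clique number. Logarithms are to base 2. For a class of graphs $\mathcal{P}$, a covering of a graph $G$ by graphs of class $\mathcal{P}$ is an expression $E(G) = E(G_1) \cup \dots \cup E(G_k)$ of the edge set of $G$ as the union of the edge sets of graphs $G_1, \dots, G_k$ with $G_i \in \mathcal{P}$ for all $i \in \{1, \dots, k\}$. The cover number $c_{\mathcal{P}}(G)$ is the smallest $k$ such that $G$ admits a covering by $k$ graphs of class $\mathcal{P}$. A graph class $\mathcal{P}$ is $\chi$-bounded with $\chi$-binding function $f$ if every graph $G \in \mathcal{P}$ satisfies $\chi(G) \leq f(\omega(G))$. *)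

theory Defs
  imports "Graph_Theory.Graph_Theory" "HOL-Library.Extended_Real"
begin

(* A finite simple graph is a pair_graph: a finite vertex set with a symmetric, irreflexive
   arc relation. An undirected edge is represented by its two orientations, so equality and
   union of edge sets are equality and union of the arc relations. *)

definition proper_coloring :: "'a pair_pre_digraph \<Rightarrow> nat \<Rightarrow> ('a \<Rightarrow> nat) \<Rightarrow> bool" where
  "proper_coloring G k c \<longleftrightarrow>
     (\<forall>v\<in>pverts G. c v < k) \<and> (\<forall>(u, v)\<in>parcs G. c u \<noteq> c v)"

definition chromatic_number :: "'a pair_pre_digraph \<Rightarrow> nat" where
  "chromatic_number G = (LEAST k. \<exists>c. proper_coloring G k c)"

definition clique :: "'a pair_pre_digraph \<Rightarrow> 'a set \<Rightarrow> bool" where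
  "clique G K \<longleftrightarrow>
     K \<subseteq> pverts G \<and> (\<forall>u\<in>K. \<forall>v\<in>K. u \<noteq> v \<longrightarrow> (u, v) \<in> parcs G)"

definition clique_number :: "'a pair_pre_digraph \<Rightarrow> nat" where
  "clique_number G = Max {card K | K. clique G K}"

definition has_covering :: "'a pair_pre_digraph set \<Rightarrow> 'a pair_pre_digraph \<Rightarrow> nat \<Rightarrow> bool" where
  "has_covering P G k \<longleftrightarrow>
     (\<exists>H. (\<forall>i\<in>{1..k}. H i \<in> P) \<and> parcs G = (\<Union>i\<in>{1..k}. parcs (H i)))"

(* The infimum of the empty set is infinity: this is the value when G has no covering.
   A graph without edges has the empty covering, hence cover number 0. *)
definition cover_number :: "'a pair_pre_digraph set \<Rightarrow> 'a pair_pre_digraph \<Rightarrow> enat" where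
  "cover_number P G = Inf {enat k | k. has_covering P G k}"

definition chi_bounded_by :: "'a pair_pre_digraph set \<Rightarrow> (nat \<Rightarrow> nat) \<Rightarrow> bool" where
  "chi_bounded_by P f \<longleftrightarrow> (\<forall>G\<in>P. chromatic_number G \<le> f (clique_number G))"

(* For f n >= n, the quotient log (chi G) / log (f (omega G)) is degenerate only when G has no
   edges. Then chi G <= 1, so log 2 0 = 0, log 2 1 = 0 and x / 0 = 0 make it 0. *)

end

theory Submission
  imports Defs
begin

text \<open>
  If the edges of \<open>G\<close> are covered by graphs \<open>H\<^sub>1, \<dots>, H\<^sub>k\<close> that can all be coloured with \<open>m\<close>
  colours, then the vector of the \<open>k\<close> colours of a vertex is a proper colouring of \<open>G\<close> with
  \<open>m ^ k\<close> colours (\<open>product_coloring\<close>), so \<open>\<chi>(G) \<le> m ^ k\<close>. If \<open>G\<close> has an edge, every \<open>H\<^sub>i\<close>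
  satisfies \<open>\<omega>(H\<^sub>i) \<le> \<omega>(G)\<close>, because a clique with two or more vertices consists of endpoints of
  edges; since \<open>f\<close> is monotone, \<open>m = f (\<omega>(G))\<close> colours suffice for each \<open>H\<^sub>i\<close>, and taking
  logarithms bounds \<open>k\<close> from below. Conversely, a member of the class covers itself, so its cover
  number is at most 1, and the inequality then says \<open>\<chi>(G) \<le> f (\<omega>(G))\<close>.

  A graph without edges has \<open>\<chi>(G) \<le> 1\<close>, so its bound is 0, and \<open>\<chi>(G) \<le> \<omega>(G) \<le> f (\<omega>(G))\<close>
  holds for it directly. In a graph with an edge, \<open>\<chi>\<close> and \<open>\<omega>\<close> are at least 2, so both logarithms
  are positive.
\<close>

section \<open>Chromatic number\<close>

lemma chromatic_number_le: "proper_coloring G k c \<Longrightarrow> chromatic_number G \<le> k"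
  unfolding chromatic_number_def by (rule Least_le) blast

lemma proper_coloring_mono:
  "proper_coloring G k c \<Longrightarrow> k \<le> l \<Longrightarrow> proper_coloring G l c"
  unfolding proper_coloring_def by fastforce

text \<open>Finitely many vertices admit an injective colouring, and it is proper since no edge is a loop.
  So the minimum in the chromatic number is over a nonempty set and is attained.\<close>

lemma ex_coloring_chromatic_number:
  assumes "pair_graph G"
  shows "\<exists>c. proper_coloring G (chromatic_number G) c"
proof -
  interpret pair_graph G by fact
  obtain c :: "'a \<Rightarrow> nat" and n where "c ` pverts G = {i. i < n}" "inj_on c (pverts G)"
    using finite_imp_inj_to_nat_seg[OF finite_verts] by auto
  then have "proper_coloring G n c"
    unfolding proper_coloring_def
    using in_arcsD1 in_arcsD2 no_loops by (fastforce dest: inj_onD)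
  then have "\<exists>k c. proper_coloring G k c" by blast
  then show ?thesis
    unfolding chromatic_number_def by (rule LeastI_ex)
qed

lemma chromatic_number_edgeless:
  assumes "parcs G = {}"
  shows "chromatic_number G \<le> (if pverts G = {} then 0 else 1)"
  using assms by (intro chromatic_number_le[where c = "\<lambda>_. 0"]) (auto simp: proper_coloring_def)

lemma chromatic_number_ge_2:
  assumes "pair_graph G" and "parcs G \<noteq> {}"
  shows "2 \<le> chromatic_number G"
proof -
  interpret pair_graph G by fact
  obtain c where c: "proper_coloring G (chromatic_number G) c"
    using ex_coloring_chromatic_number[OF assms(1)] by blast
  obtain u v where "(u, v) \<in> parcs G" using assms(2) by auto
  then have "c u < chromatic_number G" "c v < chromatic_number G" "c u \<noteq> c v"
    using c in_arcsD1 in_arcsD2 unfolding proper_coloring_def by auto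
  then show ?thesis by linarith
qed

text \<open>The colours of a vertex under the \<open>k\<close> colourings are the digits of one number in base
  \<open>m\<close>. The colours are bounded on all of the type, not only on the vertices of some graph, because
  the graphs of a covering need not have the same vertices.\<close>

lemma product_coloring:
  fixes R :: "nat \<Rightarrow> ('a \<times> 'a) set" and m :: nat
  assumes "\<forall>i\<in>{1..k}. \<exists>c :: 'a \<Rightarrow> nat. (\<forall>v. c v < m) \<and> (\<forall>(u, v)\<in>R i. c u \<noteq> c v)"
  shows "\<exists>c :: 'a \<Rightarrow> nat. (\<forall>v. c v < m ^ k) \<and> (\<forall>(u, v)\<in>(\<Union>i\<in>{1..k}. R i). c u \<noteq> c v)"
  using assms
proof (induction k)
  case 0
  show ?case by (intro exI[of _ "\<lambda>_. 0"]) simp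
next
  case (Suc k)
  obtain c where c: "\<And>v. c v < m ^ k" "\<And>u v. (u, v) \<in> (\<Union>i\<in>{1..k}. R i) \<Longrightarrow> c u \<noteq> c v"
    using Suc.IH Suc.prems by fastforce
  obtain d where d: "\<And>v. d v < m" "\<And>u v. (u, v) \<in> R (Suc k) \<Longrightarrow> d u \<noteq> d v"
    using Suc.prems by fastforce
  define e where "e v = m ^ k * d v + c v" for v
  have div: "e v div m ^ k = d v" and mod: "e v mod m ^ k = c v" for v
    using c(1)[of v] d(1)[of v] by (auto simp: e_def div_plus_div_distrib_dvd_left)
  have "e v < m ^ Suc k" for v
  proof -
    have "e v < m ^ k * Suc (d v)" using c(1)[of v] by (simp add: e_def)
    also have "\<dots> \<le> m ^ k * m" by (rule mult_le_mono2) (use d(1)[of v] in simp)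
    finally show ?thesis by (simp add: mult.commute)
  qed
  moreover have "e u \<noteq> e v" if "(u, v) \<in> (\<Union>i\<in>{1..Suc k}. R i)" for u v
  proof -
    from that have "(u, v) \<in> (\<Union>i\<in>{1..k}. R i) \<or> (u, v) \<in> R (Suc k)"
      by (auto simp: le_Suc_eq)
    then show ?thesis using c(2) d(2) div mod by metis
  qed
  ultimately show ?case by blast
qed

section \<open>Clique number\<close>

lemma clique_sizes:
  assumes "pair_graph G"
  shows "finite {card K | K. clique G K}" and "0 \<in> {card K | K. clique G K}"
proof -
  interpret pair_graph G by fact
  have "{card K | K. clique G K} \<subseteq> card ` Pow (pverts G)" by (auto simp: clique_def)
  then show "finite {card K | K. clique G K}"
    using finite_verts by (meson finite_Pow_iff finite_imageI finite_subset)
  have "clique G {}" by (simp add: clique_def)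
  then show "0 \<in> {card K | K. clique G K}" by force
qed

lemma card_le_clique_number:
  assumes "pair_graph G" and "clique G K"
  shows "card K \<le> clique_number G"
  unfolding clique_number_def using assms by (intro Max_ge clique_sizes) auto

lemma clique_number_leI:
  assumes "pair_graph G" and "\<And>K. clique G K \<Longrightarrow> card K \<le> n"
  shows "clique_number G \<le> n"
  unfolding clique_number_def using assms clique_sizes[OF assms(1)]
  by (subst Max_le_iff) auto

lemma clique_number_ge_2:
  assumes "pair_graph G" and "parcs G \<noteq> {}"
  shows "2 \<le> clique_number G"
proof -
  interpret pair_graph G by fact
  obtain u v where uv: "(u, v) \<in> parcs G" using assms(2) by auto
  then have "u \<noteq> v" using no_loops by fastforce
  moreover have "(v, u) \<in> parcs G" using uv arcs_symmetric by blast
  ultimately have "clique G {u, v}" "card {u, v} = 2"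
    using uv in_arcsD1 in_arcsD2 by (auto simp: clique_def)
  then show ?thesis using card_le_clique_number[OF assms(1)] by metis
qed

text \<open>The vertices of \<open>H\<close> need not be vertices of \<open>G\<close>, so a clique of \<open>H\<close> with a single vertex may
  fail to be a clique of \<open>G\<close>. The edge of \<open>G\<close> accounts for these.\<close>

lemma clique_number_mono:
  assumes "pair_graph G" and "pair_graph H" and "parcs H \<subseteq> parcs G" and "parcs G \<noteq> {}"
  shows "clique_number H \<le> clique_number G"
proof (rule clique_number_leI[OF assms(2)])
  interpret pair_graph G by fact
  fix K assume K: "clique H K"
  show "card K \<le> clique_number G"
  proof (cases "card K \<le> 1")
    case True
    then show ?thesis using clique_number_ge_2[OF assms(1,4)] by linarith
  next
    case False
    have "u \<in> pverts G" if "u \<in> K" for u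
    proof -
      obtain v where "v \<in> K" "v \<noteq> u"
        using False by (metis One_nat_def card_eq_0_iff card_le_Suc0_iff_eq le0 that)
      then have "(u, v) \<in> parcs G" using K that assms(3) by (auto simp: clique_def)
      then show ?thesis using in_arcsD1 by blast
    qed
    then have "clique G K" using K assms(3) by (auto simp: clique_def)
    then show ?thesis by (rule card_le_clique_number[OF assms(1)])
  qed
qed

lemma chromatic_number_le_clique_number_edgeless:
  assumes "pair_graph G" and "parcs G = {}"
  shows "chromatic_number G \<le> clique_number G"
proof (cases "pverts G = {}")
  case True
  then show ?thesis using chromatic_number_edgeless[OF assms(2)] by simp
next
  case False
  then obtain v where "v \<in> pverts G" by auto
  then have "clique G {v}" by (simp add: clique_def)
  then have "1 \<le> clique_number G" using card_le_clique_number[OF assms(1)] by fastforce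
  then show ?thesis using chromatic_number_edgeless[OF assms(2)] False by simp
qed

section \<open>Coverings\<close>

lemma cover_number_le: "has_covering P G k \<Longrightarrow> cover_number P G \<le> enat k"
  unfolding cover_number_def by (rule Inf_lower) blast

lemma has_covering_self: "G \<in> P \<Longrightarrow> has_covering P G 1"
  unfolding has_covering_def by (intro exI[of _ "\<lambda>_. G"]) simp

text \<open>The infimum that defines the cover number is over a set of natural numbers, so it is
  attained unless it is infinite.\<close>

lemma le_cover_numberI:
  assumes "\<And>k. has_covering P G k \<Longrightarrow> x \<le> ereal (real k)"
  shows "x \<le> ereal_of_enat (cover_number P G)"
proof (cases "{enat k | k. has_covering P G k} = {}")
  case True
  then show ?thesis by (simp add: cover_number_def Inf_enat_def)
next
  case False
  then obtain y where "y \<in> {enat k | k. has_covering P G k}" by blast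
  then have "cover_number P G \<in> {enat k | k. has_covering P G k}"
    unfolding cover_number_def Inf_enat_def if_not_P[OF False] by (rule LeastI)
  then show ?thesis using assms by auto
qed

lemma chromatic_number_le_power_covering:
  fixes P :: "'a pair_pre_digraph set" and f :: "nat \<Rightarrow> nat"
  assumes P: "\<forall>G\<in>P. pair_graph G" "chi_bounded_by P f"
    and f: "mono f" "\<forall>n. n \<le> f n"
    and G: "pair_graph G" "parcs G \<noteq> {}" "has_covering P G k"
  shows "chromatic_number G \<le> f (clique_number G) ^ k"
proof -
  let ?m = "f (clique_number G)"
  have m: "0 < ?m"
    using clique_number_ge_2[OF G(1,2)] f(2) by (metis le_trans not_gr0 not_numeral_le_zero)
  obtain H where H: "\<forall>i\<in>{1..k}. H i \<in> P" "parcs G = (\<Union>i\<in>{1..k}. parcs (H i))"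
    using G(3) by (auto simp: has_covering_def)
  have "\<exists>c :: 'a \<Rightarrow> nat. (\<forall>v. c v < ?m) \<and> (\<forall>(u, v)\<in>parcs (H i). c u \<noteq> c v)"
    if i: "i \<in> {1..k}" for i
  proof -
    have Hi: "H i \<in> P" "pair_graph (H i)" "parcs (H i) \<subseteq> parcs G"
      using H P(1) i by auto
    interpret pair_graph "H i" by fact
    have "chromatic_number (H i) \<le> f (clique_number (H i))"
      using P(2) Hi(1) by (simp add: chi_bounded_by_def)
    also have "\<dots> \<le> ?m"
      using clique_number_mono[OF G(1) Hi(2,3) G(2)] f(1) by (rule monoD[rotated])
    finally obtain c where c: "proper_coloring (H i) ?m c"
      using ex_coloring_chromatic_number[OF Hi(2)] proper_coloring_mono by blast
    show ?thesis
      \<comment> \<open>Any colour will do outside \<open>H i\<close>, and colour 0 exists because \<open>f (\<omega>(G))\<close> is positive.\<close>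
      using c m in_arcsD1 in_arcsD2
      by (intro exI[of _ "\<lambda>v. if v \<in> pverts (H i) then c v else 0"])
        (auto simp: proper_coloring_def)
  qed
  then obtain c :: "'a \<Rightarrow> nat" where
    "\<forall>v. c v < ?m ^ k" "\<forall>(u, v)\<in>(\<Union>i\<in>{1..k}. parcs (H i)). c u \<noteq> c v"
    using product_coloring[of k ?m "\<lambda>i. parcs (H i)"] by blast
  then have "proper_coloring G (?m ^ k) c" using H(2) by (simp add: proper_coloring_def)
  then show ?thesis by (rule chromatic_number_le)
qed

section \<open>The characterization\<close>

lemma ceiling_log_quotient_le_iff:
  fixes x m k :: nat
  assumes "0 < x" and "1 < m"
  shows "real_of_int \<lceil>log 2 (real x) / log 2 (real m)\<rceil> \<le> real k \<longleftrightarrow> x \<le> m ^ k"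
proof -
  have "log 2 (real x) / log 2 (real m) = log (real m) (real x)"
    using assms by (simp add: log_def)
  then have "real_of_int \<lceil>log 2 (real x) / log 2 (real m)\<rceil> \<le> real k
      \<longleftrightarrow> log (real m) (real x) \<le> real k"
    by (metis ceiling_le_iff of_int_le_iff of_int_of_nat_eq)
  also have "\<dots> \<longleftrightarrow> real x \<le> real m ^ k"
    using assms by (simp add: log_le_iff powr_realpow)
  also have "\<dots> \<longleftrightarrow> x \<le> m ^ k"
    by (metis of_nat_le_iff of_nat_power)
  finally show ?thesis .
qed

theorem corollary5:
  fixes P :: "'a pair_pre_digraph set" and f :: "nat \<Rightarrow> nat"
  assumes "\<forall>G\<in>P. pair_graph G"
    and "mono f"
    and "\<forall>n. n \<le> f n"
  shows "chi_bounded_by P f \<longleftrightarrow>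
    (\<forall>G :: 'a pair_pre_digraph. pair_graph G \<longrightarrow>
      ereal_of_enat (cover_number P G) \<ge>
        ereal (real_of_int
          \<lceil>log 2 (real (chromatic_number G)) / log 2 (real (f (clique_number G)))\<rceil>))"
proof -
  let ?bound = "\<lambda>G :: 'a pair_pre_digraph.
    real_of_int \<lceil>log 2 (real (chromatic_number G)) / log 2 (real (f (clique_number G)))\<rceil>"
  have bound_iff: "?bound G \<le> real k \<longleftrightarrow> chromatic_number G \<le> f (clique_number G) ^ k"
    if "pair_graph G" "parcs G \<noteq> {}" for G k
  proof (rule ceiling_log_quotient_le_iff)
    show "0 < chromatic_number G" using chromatic_number_ge_2[OF that] by simp
    show "1 < f (clique_number G)"
      using clique_number_ge_2[OF that] assms(3)
      by (metis One_nat_def Suc_1 Suc_le_eq le_trans)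
  qed
  show ?thesis
  proof (intro iffI allI impI)
    fix G :: "'a pair_pre_digraph"
    assume bounded: "chi_bounded_by P f" and G: "pair_graph G"
    show "ereal (?bound G) \<le> ereal_of_enat (cover_number P G)"
    proof (cases "parcs G = {}")
      case True
      then have "chromatic_number G = 0 \<or> chromatic_number G = 1"
        using chromatic_number_edgeless[OF True] by (auto split: if_splits)
      then have "?bound G = 0" by (auto simp: log_def)
      then show ?thesis by (simp add: zero_ereal_def[symmetric])
    next
      case False
      show ?thesis
      proof (rule le_cover_numberI)
        fix k assume "has_covering P G k"
        then show "ereal (?bound G) \<le> ereal (real k)"
          using chromatic_number_le_power_covering[OF assms(1) bounded assms(2,3) G False]
            bound_iff[OF G False] by simp
      qed
    qed
  next
    assume R: "\<forall>G. pair_graph G \<longrightarrow> ereal (?bound G) \<le> ereal_of_enat (cover_number P G)"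
    show "chi_bounded_by P f"
      unfolding chi_bounded_by_def
    proof
      fix G assume "G \<in> P"
      then have G: "pair_graph G" using assms(1) by blast
      show "chromatic_number G \<le> f (clique_number G)"
      proof (cases "parcs G = {}")
        case True
        then show ?thesis
          using chromatic_number_le_clique_number_edgeless[OF G] assms(3) le_trans by blast
      next
        case False
        have "ereal (?bound G) \<le> ereal_of_enat (cover_number P G)" using R G by blast
        also have "\<dots> \<le> ereal_of_enat (enat 1)"
          using cover_number_le[OF has_covering_self[OF \<open>G \<in> P\<close>]] by (simp only: ereal_of_enat_le_iff)
        finally have "?bound G \<le> real 1" by simp
        then show ?thesis using bound_iff[OF G False, of 1] by simp
      qed
    qed
  qed
qed

end
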